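(* For every $m,n\in\mathbb{N}$ the number $c(m,n)$ of cyclic subgroups of the group $\mathbb{Z}_m\times\mathbb{Z}_n$ is $$c(m,n)=\sum_{i\mid m,\ j\mid n}\phi(\gcd(i,j))=\sum_{t\mid\gcd(m,n)}(\mu*\phi)(t)\,\tau\left(\frac{m}{t}\right)\tau\left(\frac{n}{t}\right).$$
   Context: $\mathbb{N}=\{1,2,\ldots\}$. $\mathbb{Z}_m$ denotes the additive group of residue classes modulo $m$. $\phi$ is Euler's totient function, $\mu$ is the Möbius function, $\tau(k)$ is the number of positive divisors of $k$, and $*$ is the Dirichlet convolution of arithmetic functions, $(f*g)(t)=\sum_{d\mid t}f(d)g(t/d)$. Sums over divisors run over positive divisors. *)

theory Defs
  imports
    "HOL-Algebra.Elementary_Groups"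
    "HOL-Number_Theory.Totient"
    "HOL-Computational_Algebra.Squarefree"
begin

definition cyclic_subgroups :: "('a, 'b) monoid_scheme \<Rightarrow> 'a set set" where
  "cyclic_subgroups G = {H. subgroup H G \<and> cyclic_group (G\<lparr>carrier := H\<rparr>)}"

definition num_cyclic_subgroups :: "nat \<Rightarrow> nat \<Rightarrow> nat" where
  "num_cyclic_subgroups m n =
     card (cyclic_subgroups (integer_mod_group m \<times>\<times> integer_mod_group n))"

(* Arithmetic functions are total on nat; their values at 0 carry no meaning. *)

definition moebius_mu :: "nat \<Rightarrow> int" where
  "moebius_mu n = (if squarefree n then (- 1) ^ card (prime_factors n) else 0)"

definition num_divisors :: "nat \<Rightarrow> nat" where
  "num_divisors n = card {d. d dvd n}"

definition dirichlet_conv :: "(nat \<Rightarrow> 'a) \<Rightarrow> (nat \<Rightarrow> 'a) \<Rightarrow> nat \<Rightarrow> 'a::comm_semiring_1" where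
  "dirichlet_conv f g t = (\<Sum>d | d dvd t. f d * g (t div d))"

end

theory Submission
  imports Defs "HOL-Algebra.Multiplicative_Group"
begin

text \<open>
  Call \<open>(i, j)\<close> the type of an element \<open>(a, b)\<close> of \<open>\<int>\<^sub>m \<times> \<int>\<^sub>n\<close> if \<open>a\<close> has order \<open>i\<close> and \<open>b\<close> has order
  \<open>j\<close>. All generators of a cyclic subgroup have the same type, because each is a power of the other.
  There are \<open>\<phi>(i) \<phi>(j)\<close> elements of type \<open>(i, j)\<close>, each generating a subgroup of order \<open>lcm i j\<close>,
  which has \<open>\<phi>(lcm i j)\<close> generators. So type \<open>(i, j)\<close> accounts for
  \<open>\<phi>(i) \<phi>(j) / \<phi>(lcm i j) = \<phi>(gcd i j)\<close> cyclic subgroups. The second equality is Moebius inversion: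
  write \<open>\<phi>(gcd i j)\<close> as the sum of \<open>(\<mu> * \<phi>)(t)\<close> over the common divisors \<open>t\<close> of \<open>i\<close> and \<open>j\<close>, and
  exchange the sums.
\<close>

section \<open>Orders in a direct product\<close>

lemma nat_pow_DirProd:
  "(a, b) [^]\<^bsub>G \<times>\<times> H\<^esub> (k::nat) = (a [^]\<^bsub>G\<^esub> k, b [^]\<^bsub>H\<^esub> k)"
  by (induction k) (simp_all add: nat_pow_def)

text \<open>A power \<open>k\<close> kills \<open>(a, b)\<close> iff both component orders divide
  \<open>k\<close>, that is, iff their lcm does; this divisibility property characterises the
  order.\<close>

lemma ord_DirProd:
  assumes "group G" "group H" "a \<in> carrier G" "b \<in> carrier H"
  shows "group.ord (G \<times>\<times> H) (a, b) = lcm (group.ord G a) (group.ord H b)"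
proof -
  interpret G: group G by fact
  interpret H: group H by fact
  interpret GH: group "G \<times>\<times> H" by (rule DirProd_group) fact+
  show ?thesis
    using assms by (subst GH.ord_unique) (auto simp: nat_pow_DirProd G.pow_eq_id H.pow_eq_id)
qed

section \<open>Cyclic subgroups and their generators\<close>

context group
begin

lemma cyclic_subgroups_eq_image_generate:
  "cyclic_subgroups G = (\<lambda>x. generate G {x}) ` carrier G"
proof (intro equalityI subsetI)
  fix K assume "K \<in> cyclic_subgroups G"
  then have K: "subgroup K G" and "cyclic_group (G\<lparr>carrier := K\<rparr>)"
    by (auto simp: cyclic_subgroups_def)
  then obtain x where x: "x \<in> K"
    and gen: "subgroup_generated (G\<lparr>carrier := K\<rparr>) {x} = G\<lparr>carrier := K\<rparr>"
    by (auto simp: cyclic_group_def)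
  from arg_cong[OF gen, of carrier] have "generate (G\<lparr>carrier := K\<rparr>) {x} = K"
    using x by (simp add: carrier_subgroup_generated)
  then have "generate G {x} = K"
    using generate_consistent[of "{x}" K] x K by simp
  then show "K \<in> (\<lambda>x. generate G {x}) ` carrier G"
    using x subgroup.subset[OF K] by blast
next
  fix K assume "K \<in> (\<lambda>x. generate G {x}) ` carrier G"
  then obtain x where x: "x \<in> carrier G" and K: "K = generate G {x}" by blast
  have "subgroup K G" unfolding K by (rule generate_is_subgroup) (simp add: x)
  moreover have "cyclic_group (G\<lparr>carrier := K\<rparr>)"
    using cyclic_group_generated[of x] x by (simp add: subgroup_generated_def K)
  ultimately show "K \<in> cyclic_subgroups G" by (simp add: cyclic_subgroups_def)
qed

text \<open>With \<open>N = ord a\<close>, the power \<open>a [^] k\<close> has order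
  \<open>N div gcd k N\<close>, so the count is over exponents \<open>k\<close> with
  \<open>gcd k N = N div d\<close>. It serves both for the generators of a cyclic subgroup
  (\<open>d = ord a\<close>) and for all orders in a residue group.\<close>

lemma card_generate_ord_eq:
  assumes a: "a \<in> carrier G" and nz: "ord a \<noteq> 0" and d: "d dvd ord a"
  shows "card {x \<in> generate G {a}. ord x = d} = totient d"
proof -
  let ?N = "ord a"
  \<comment> \<open>Exponents run over \<open>{0<..?N}\<close>, the range on which
    \<open>card_gcd_eq_totient\<close> counts; the identity is represented by exponent
    \<open>?N\<close> instead of 0.\<close>
  have gen: "generate G {a} = (\<lambda>k. a [^] k) ` {0<..?N}"
  proof (intro equalityI subsetI)
    fix x assume "x \<in> generate G {a}"
    then obtain k where k: "x = a [^] k" "k \<in> {0..?N - 1}"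
      using generate_pow_nat[OF a nz] ord_elems_inf_carrier[OF a nz] by blast
    show "x \<in> (\<lambda>k. a [^] k) ` {0<..?N}"
    proof (cases "k = 0")
      case True
      then show ?thesis using k a nz by (intro image_eqI[of _ _ ?N]) auto
    qed (use k nz in auto)
  qed (use generate_pow_nat[OF a nz] in auto)
  have iff: "ord (a [^] k) = d \<longleftrightarrow> gcd k ?N = ?N div d" if "k \<in> {0<..?N}" for k
  proof -
    have "ord (a [^] k) = ?N div gcd k ?N"
      using ord_pow_gen[OF a, of k] that by (simp add: gcd.commute)
    moreover have "?N div g = d \<longleftrightarrow> g = ?N div d" if "g dvd ?N" for g
      using d nz that by (auto elim!: dvdE)
    ultimately show ?thesis by simp
  qed
  have "{x \<in> generate G {a}. ord x = d} = (\<lambda>k. a [^] k) ` {k \<in> {0<..?N}. gcd k ?N = ?N div d}"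
    unfolding gen using iff by blast
  moreover have "inj_on (\<lambda>k. a [^] k) {k \<in> {0<..?N}. gcd k ?N = ?N div d}"
    by (rule inj_on_subset[OF ord_inj'[OF a]]) auto
  ultimately have "card {x \<in> generate G {a}. ord x = d} = card {k \<in> {0<..?N}. gcd k ?N = ?N div d}"
    by (simp add: card_image)
  also have "\<dots> = totient (?N div (?N div d))"
    using nz d by (intro card_gcd_eq_totient) auto
  also have "?N div (?N div d) = d"
    using d nz by (auto elim!: dvdE)
  finally show ?thesis .
qed

text \<open>By finiteness, \<open>x\<close> generates the same subgroup as \<open>a\<close> iff it
  lies in that subgroup and has order \<open>ord a\<close>: a subset of equal cardinality is
  everything.\<close>

lemma card_same_generate:
  assumes fin: "finite (carrier G)" and a: "a \<in> carrier G"
  shows "card {x \<in> carrier G. generate G {x} = generate G {a}} = totient (ord a)"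
proof -
  have sub: "generate G {a} \<subseteq> carrier G" using a generate_incl by simp
  have "generate G {x} = generate G {a} \<longleftrightarrow> x \<in> generate G {a} \<and> ord x = ord a"
    if x: "x \<in> carrier G" for x
  proof
    assume "generate G {x} = generate G {a}"
    then show "x \<in> generate G {a} \<and> ord x = ord a"
      using generate.incl[of x "{x}"] a x by (auto simp: generate_pow_card)
  next
    assume *: "x \<in> generate G {a} \<and> ord x = ord a"
    then have "generate G {x} \<subseteq> generate G {a}"
      using a by (intro generate_subgroup_incl generate_is_subgroup) auto
    then show "generate G {x} = generate G {a}"
      using * a x sub fin by (intro card_subset_eq) (auto simp: generate_pow_card intro: finite_subset)
  qed
  then have "{x \<in> carrier G. generate G {x} = generate G {a}} = {x \<in> generate G {a}. ord x = ord a}"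
    using sub by blast
  then show ?thesis
    using card_generate_ord_eq[OF a _ dvd_refl] ord_ge_1[OF fin a] by simp
qed

end

section \<open>Element orders in residue groups and in cyclic subgroups of products\<close>

lemma card_integer_mod_group_ord_eq:
  assumes "n > 0" "d dvd n"
  shows "card {x \<in> carrier (integer_mod_group n). group.ord (integer_mod_group n) x = d} = totient d"
proof -
  interpret group "integer_mod_group n" by simp
  \<comment> \<open>Reducing the generator 1 covers \<open>n = 1\<close>, where the carrier is
    \<open>{0}\<close>.\<close>
  let ?a = "1 mod int n"
  have a: "?a \<in> carrier (integer_mod_group n)"
    using assms by (simp add: carrier_integer_mod_group)
  have "int k * ?a mod int n = 0 \<longleftrightarrow> n dvd k" for k
    by (simp add: mod_mult_right_eq mod_eq_0_iff_dvd)
  then have ord_a: "ord ?a = n"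
    by (subst ord_unique[OF a]) simp
  have "generate (integer_mod_group n) {?a} = carrier (integer_mod_group n)"
  proof (rule card_subset_eq)
    show "generate (integer_mod_group n) {?a} \<subseteq> carrier (integer_mod_group n)"
      by (rule generate_incl) (use a in simp)
  qed (use assms ord_a in \<open>simp_all add: carrier_integer_mod_group flip: generate_pow_card[OF a]\<close>)
  then show ?thesis
    using card_generate_ord_eq[OF a, of d] ord_a assms by simp
qed

text \<open>Both components of an element of the subgroup are powers of \<open>a\<close> and
  \<open>b\<close> with the same exponent, and the order of a power divides that of its
  base.\<close>

lemma generate_DirProd_imp_ord_dvd:
  assumes "group G" "group H" "finite (carrier G)" "finite (carrier H)"
    and "a \<in> carrier G" "b \<in> carrier H"
    and "(a', b') \<in> generate (G \<times>\<times> H) {(a, b)}"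
  shows "group.ord G a' dvd group.ord G a" "group.ord H b' dvd group.ord H b"
proof -
  interpret G: group G by fact
  interpret H: group H by fact
  interpret GH: group "G \<times>\<times> H" by (rule DirProd_group) fact+
  obtain k :: nat where "a' = a [^]\<^bsub>G\<^esub> k" "b' = b [^]\<^bsub>H\<^esub> k"
    using assms GH.generate_pow_on_finite_carrier[of "(a, b)"] by (auto simp: nat_pow_DirProd)
  then show "group.ord G a' dvd group.ord G a" "group.ord H b' dvd group.ord H b"
    using assms
    by (auto intro!: G.pow_eq_id[THEN iffD1] H.pow_eq_id[THEN iffD1]
        simp: G.nat_pow_pow H.nat_pow_pow G.pow_eq_id H.pow_eq_id)
qed

section \<open>Moebius inversion and divisor sums\<close>

lemma moebius_mu_prime_mult:
  assumes p: "prime p" and "\<not> p dvd d"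
  shows "moebius_mu (p * d) = - moebius_mu d"
proof (cases "squarefree d")
  case True
  have cop: "coprime p d" using assms by (simp add: prime_imp_coprime)
  have "d \<noteq> 0" using True by (cases "d = 0") auto
  have "squarefree (p * d)"
    using cop True squarefree_prime[OF p] by (intro squarefree_mult_coprime)
  moreover have "prime_factors (p * d) = insert p (prime_factors d)"
    using p \<open>d \<noteq> 0\<close> by (simp add: prime_factors_product prime_prime_factors)
  moreover have "p \<notin> prime_factors d" using assms by auto
  ultimately show ?thesis using True by (simp add: moebius_mu_def)
next
  case False
  then show ?thesis by (auto simp: moebius_mu_def dest: squarefree_multD)
qed

lemma sum_moebius_mu_divisors:
  assumes "n > 0"
  shows "(\<Sum>d | d dvd n. moebius_mu d) = (if n = 1 then 1 else 0)"
proof (cases "n = 1")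
  case False
  then obtain p where p: "prime p" "p dvd n" using prime_factor_nat by blast
  have fin: "finite {d. d dvd n}" using assms by simp
  let ?A = "{d. d dvd n \<and> squarefree d \<and> \<not> p dvd d}"
  let ?B = "{d. d dvd n \<and> squarefree d \<and> p dvd d}"
  have finA: "finite ?A" and finB: "finite ?B" using fin by (auto intro: finite_subset)
  \<comment> \<open>Multiplication by \<open>p\<close> matches up the squarefree divisors with opposite values of \<open>\<mu>\<close>.\<close>
  have "bij_betw (\<lambda>d. p * d) ?A ?B"
  proof (rule bij_betw_byWitness[where f' = "\<lambda>d. d div p"])
    show "(\<lambda>d. p * d) ` ?A \<subseteq> ?B"
      using p by (auto intro!: divides_mult squarefree_mult_coprime intro: squarefree_prime prime_imp_coprime)
    show "(\<lambda>d. d div p) ` ?B \<subseteq> ?A"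
    proof (intro subsetI, elim imageE CollectE conjE dvdE[of p])
      fix x d k assume *: "x = d div p" "d dvd n" "squarefree d" "d = p * k"
      have "\<not> p dvd k"
      proof
        assume "p dvd k"
        then have "p ^ 2 dvd d" using * by (simp add: power2_eq_square)
        then show False using * squarefreeD[of d p] p by auto
      qed
      then show "x \<in> ?A"
        using * p squarefree_multD[of p k] by (auto dest: dvd_mult_right simp: prime_gt_0_nat)
    qed
  qed (use p in \<open>auto simp: prime_gt_0_nat\<close>)
  then have "(\<Sum>d\<in>?B. moebius_mu d) = (\<Sum>d\<in>?A. moebius_mu (p * d))"
    by (rule sum.reindex_bij_betw[symmetric])
  also have "\<dots> = - (\<Sum>d\<in>?A. moebius_mu d)"
    using p by (simp add: moebius_mu_prime_mult sum_negf)
  finally have "(\<Sum>d\<in>?A \<union> ?B. moebius_mu d) = 0"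
    by (subst sum.union_disjoint) (use finA finB in auto)
  moreover have "(\<Sum>d | d dvd n. moebius_mu d) = (\<Sum>d\<in>?A \<union> ?B. moebius_mu d)"
    by (rule sum.mono_neutral_right) (use fin in \<open>auto simp: moebius_mu_def\<close>)
  ultimately show ?thesis using False by simp
qed (simp add: moebius_mu_def)

text \<open>Both sides run over the pairs \<open>(d, e)\<close> with \<open>d * e\<close> dividing
  \<open>k\<close>; on the left, \<open>t = d * e\<close>.\<close>

lemma sum_divisors_swap:
  fixes f :: "nat \<Rightarrow> nat \<Rightarrow> 'a::comm_monoid_add"
  assumes "k > 0"
  shows "(\<Sum>t | t dvd k. \<Sum>d | d dvd t. f d (t div d)) = (\<Sum>e | e dvd k. \<Sum>d | d dvd k div e. f d e)"
proof -
  have fin: "finite {d. d dvd x}" if "x dvd k" for x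
    using assms that by (simp add: dvd_pos_nat)
  have "(\<Sum>t | t dvd k. \<Sum>d | d dvd t. f d (t div d)) =
        (\<Sum>(t, d) \<in> (SIGMA t:{t. t dvd k}. {d. d dvd t}). f d (t div d))"
    using fin by (intro sum.Sigma) auto
  also have "\<dots> = (\<Sum>(e, d) \<in> (SIGMA e:{e. e dvd k}. {d. d dvd k div e}). f d e)"
  proof (rule sum.reindex_bij_witness[of _ "\<lambda>(e, d). (d * e, d)" "\<lambda>(t, d). (t div d, d)"])
  qed (use assms in \<open>auto elim!: dvdE\<close>)
  also have "\<dots> = (\<Sum>e | e dvd k. \<Sum>d | d dvd k div e. f d e)"
    using fin by (intro sum.Sigma[symmetric]) (auto simp: div_dvd_iff_mult)
  finally show ?thesis .
qed

lemma sum_dirichlet_conv_moebius_mu: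
  fixes f :: "nat \<Rightarrow> int"
  assumes "k > 0"
  shows "(\<Sum>t | t dvd k. dirichlet_conv moebius_mu f t) = f k"
proof -
  have mu_1: "moebius_mu (Suc 0) = 1" by (simp add: moebius_mu_def)
  have "(\<Sum>t | t dvd k. dirichlet_conv moebius_mu f t) =
        (\<Sum>e | e dvd k. (\<Sum>d | d dvd k div e. moebius_mu d) * f e)"
    unfolding dirichlet_conv_def
    using sum_divisors_swap[OF assms, of "\<lambda>d e. moebius_mu d * f e"] by (simp add: sum_distrib_right)
  \<comment> \<open>The inner Moebius sum vanishes unless \<open>k div e = 1\<close>.\<close>
  also have "\<dots> = (\<Sum>e | e dvd k. if e = k then f e else 0)"
    using assms
    by (intro sum.cong) (auto simp: sum_moebius_mu_divisors mu_1 elim!: dvdE)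
  also have "\<dots> = f k" using assms by simp
  finally show ?thesis .
qed

lemma card_multiples_dividing:
  assumes "m > 0" "t dvd m"
  shows "card {i. i dvd m \<and> t dvd i} = num_divisors (m div t)"
proof -
  have "t > 0" using assms by (rule dvd_pos_nat)
  then have "bij_betw (\<lambda>d. t * d) {d. d dvd m div t} {i. i dvd m \<and> t dvd i}"
    using assms by (intro bij_betw_byWitness[where f' = "\<lambda>i. i div t"]) (auto elim!: dvdE)
  then show ?thesis by (simp add: num_divisors_def bij_betw_same_card)
qed

lemma sum_gcd_divisors:
  fixes f :: "nat \<Rightarrow> int"
  assumes m: "m > 0" and n: "n > 0"
  shows "(\<Sum>(i, j) \<in> {i. i dvd m} \<times> {j. j dvd n}. f (gcd i j)) =
         (\<Sum>t | t dvd gcd m n. dirichlet_conv moebius_mu f t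
            * int (num_divisors (m div t)) * int (num_divisors (n div t)))"
proof -
  let ?P = "{i. i dvd m} \<times> {j. j dvd n}" and ?T = "{t. t dvd gcd m n}"
  let ?g = "dirichlet_conv moebius_mu f"
  have fin: "finite ?P" "finite ?T" using m n by simp_all
  \<comment> \<open>The divisors of \<open>gcd i j\<close> are written as a restriction of the fixed
    index set \<open>?T\<close>, so that the two sums can be exchanged.\<close>
  have "(\<Sum>(i, j) \<in> ?P. f (gcd i j)) = (\<Sum>p \<in> ?P. \<Sum>t | t \<in> ?T \<and> t dvd fst p \<and> t dvd snd p. ?g t)"
  proof (rule sum.cong[OF refl], clarify)
    fix i j assume "i dvd m" "j dvd n"
    then have "gcd i j > 0" and "{t. t \<in> ?T \<and> t dvd i \<and> t dvd j} = {t. t dvd gcd i j}"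
      using m by (auto intro: dvd_trans)
    then show "f (gcd i j) = (\<Sum>t | t \<in> ?T \<and> t dvd fst (i, j) \<and> t dvd snd (i, j). ?g t)"
      using sum_dirichlet_conv_moebius_mu[of "gcd i j" f] by simp
  qed
  also have "\<dots> = (\<Sum>t \<in> ?T. \<Sum>p | p \<in> ?P \<and> t dvd fst p \<and> t dvd snd p. ?g t)"
    using fin by (rule sum.swap_restrict)
  also have "\<dots> = (\<Sum>t \<in> ?T. ?g t * int (num_divisors (m div t)) * int (num_divisors (n div t)))"
  proof (rule sum.cong[OF refl])
    fix t assume t: "t \<in> ?T"
    \<comment> \<open>For fixed \<open>t\<close> the conditions on \<open>i\<close> and
      \<open>j\<close> are independent, which yields the product of two divisor counts.\<close>
    have "{p. p \<in> ?P \<and> t dvd fst p \<and> t dvd snd p} =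
          {i. i dvd m \<and> t dvd i} \<times> {j. j dvd n \<and> t dvd j}" by auto
    then show "(\<Sum>p | p \<in> ?P \<and> t dvd fst p \<and> t dvd snd p. ?g t) =
        ?g t * int (num_divisors (m div t)) * int (num_divisors (n div t))"
      using t m n by (simp add: card_cartesian_product card_multiples_dividing)
  qed
  finally show ?thesis .
qed

section \<open>Counting cyclic subgroups by type\<close>

context
  fixes G :: "('a, 'c) monoid_scheme" and H :: "('b, 'd) monoid_scheme"
  assumes G: "group G" and H: "group H" and finG: "finite (carrier G)" and finH: "finite (carrier H)"
begin

interpretation G: group G by (fact G)
interpretation H: group H by (fact H)
interpretation GH: group "G \<times>\<times> H" by (intro DirProd_group G H)

lemma ord_components_eq:
  assumes x: "x \<in> carrier (G \<times>\<times> H)" and y: "y \<in> carrier (G \<times>\<times> H)"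
    and eq: "generate (G \<times>\<times> H) {x} = generate (G \<times>\<times> H) {y}"
  shows "G.ord (fst x) = G.ord (fst y)" "H.ord (snd x) = H.ord (snd y)"
proof -
  have "x \<in> generate (G \<times>\<times> H) {y}" "y \<in> generate (G \<times>\<times> H) {x}"
    using eq generate.incl[of x "{x}" "G \<times>\<times> H"] generate.incl[of y "{y}" "G \<times>\<times> H"] by auto
  then show "G.ord (fst x) = G.ord (fst y)" "H.ord (snd x) = H.ord (snd y)"
    using generate_DirProd_imp_ord_dvd[OF G H finG finH, of "fst x" "snd x" "fst y" "snd y"]
      generate_DirProd_imp_ord_dvd[OF G H finG finH, of "fst y" "snd y" "fst x" "snd x"] x y
    by (auto intro: dvd_antisym)
qed

text \<open>Double counting: \<open>A i j\<close> is split into the fibres of the map sending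
  \<open>x\<close> to the subgroup it generates, each of size \<open>totient (lcm i j)\<close>. The
  product form avoids division.\<close>

lemma card_generate_image_ord_eq:
  defines "A \<equiv> \<lambda>i j. {a \<in> carrier G. G.ord a = i} \<times> {b \<in> carrier H. H.ord b = j}"
  shows "card ((\<lambda>x. generate (G \<times>\<times> H) {x}) ` A i j) * totient (lcm i j) = card (A i j)"
proof -
  let ?h = "\<lambda>x. generate (G \<times>\<times> H) {x}"
  have A_iff: "x \<in> A i j \<longleftrightarrow> x \<in> carrier (G \<times>\<times> H) \<and> G.ord (fst x) = i \<and> H.ord (snd x) = j" for x
    by (cases x) (auto simp: A_def)
  have fin: "finite (A i j)" using finG finH by (simp add: A_def)
  have "card {x \<in> A i j. ?h x = K} = totient (lcm i j)" if K: "K \<in> ?h ` A i j" for K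
  proof -
    obtain y where y: "y \<in> A i j" "K = ?h y" using K by blast
    then have yc: "y \<in> carrier (G \<times>\<times> H)" by (simp only: A_iff)
    \<comment> \<open>Since generators of one subgroup share their type, no generator of
      \<open>K\<close> lies outside \<open>A i j\<close>.\<close>
    have "{x \<in> A i j. ?h x = K} = {x \<in> carrier (G \<times>\<times> H). ?h x = ?h y}"
    proof (intro Collect_cong)
      show "x \<in> A i j \<and> ?h x = K \<longleftrightarrow> x \<in> carrier (G \<times>\<times> H) \<and> ?h x = ?h y" for x
        using y ord_components_eq[OF _ yc, of x] unfolding A_iff by metis
    qed
    moreover have "GH.ord y = lcm i j"
      using y ord_DirProd[OF G H, of "fst y" "snd y"] by (auto simp: A_iff)
    ultimately show ?thesis
      using GH.card_same_generate[OF _ yc] finG finH by simp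
  qed
  then have "(\<Sum>K \<in> ?h ` A i j. card {x \<in> A i j. ?h x = K}) = card (?h ` A i j) * totient (lcm i j)"
    by simp
  moreover have "(\<Sum>K \<in> ?h ` A i j. card {x \<in> A i j. ?h x = K}) = card (A i j)"
    using sum.image_gen[OF fin, of "\<lambda>_. 1::nat" ?h] by simp
  ultimately show ?thesis by simp
qed

end

lemma num_cyclic_subgroups_eq:
  assumes m: "m > 0" and n: "n > 0"
  shows "num_cyclic_subgroups m n =
    (\<Sum>(i, j) \<in> {i. i dvd m} \<times> {j. j dvd n}. totient (gcd i j))"
proof -
  let ?G = "integer_mod_group m" and ?H = "integer_mod_group n"
  let ?h = "\<lambda>x. generate (?G \<times>\<times> ?H) {x}" and ?P = "{i. i dvd m} \<times> {j. j dvd n}"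
  interpret G: group ?G by simp
  interpret H: group ?H by simp
  interpret GH: group "?G \<times>\<times> ?H" by (intro DirProd_group) simp_all
  have finG: "finite (carrier ?G)" and finH: "finite (carrier ?H)"
    using m n by (simp_all add: carrier_integer_mod_group)
  define A where "A = (\<lambda>(i, j). {a \<in> carrier ?G. G.ord a = i} \<times> {b \<in> carrier ?H. H.ord b = j})"
  have "order ?G = m" "order ?H = n"
    using m n by (simp_all add: order_def carrier_integer_mod_group)
  then have "G.ord a dvd m" if "a \<in> carrier ?G" for a
    using G.ord_dvd_group_order[OF that] by simp
  moreover have "H.ord b dvd n" if "b \<in> carrier ?H" for b
    using H.ord_dvd_group_order[OF that] \<open>order ?H = n\<close> by simp
  ultimately have "carrier (?G \<times>\<times> ?H) = (\<Union>p\<in>?P. A p)"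
    by (auto simp: A_def)
  then have "cyclic_subgroups (?G \<times>\<times> ?H) = (\<Union>p\<in>?P. ?h ` A p)"
    unfolding GH.cyclic_subgroups_eq_image_generate by blast
  moreover have "card (\<Union>p\<in>?P. ?h ` A p) = (\<Sum>p\<in>?P. card (?h ` A p))"
  proof (rule card_UN_disjoint)
    show "\<forall>p\<in>?P. finite (?h ` A p)"
      using finG finH by (auto simp: A_def)
    \<comment> \<open>A subgroup arising from two types would have generators of both, contradicting
      \<open>ord_components_eq\<close>.\<close>
    show "\<forall>p\<in>?P. \<forall>q\<in>?P. p \<noteq> q \<longrightarrow> ?h ` A p \<inter> ?h ` A q = {}"
    proof (intro ballI impI equals0I)
      fix p q K assume "p \<noteq> q" and K: "K \<in> ?h ` A p \<inter> ?h ` A q"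
      from K obtain x y where xy: "x \<in> A p" "y \<in> A q" and eq: "?h x = ?h y" by blast
      have "x \<in> carrier (?G \<times>\<times> ?H)" "y \<in> carrier (?G \<times>\<times> ?H)"
        using xy by (auto simp: A_def split: prod.splits)
      from ord_components_eq[OF G.is_group H.is_group finG finH this eq] xy \<open>p \<noteq> q\<close>
      show False by (auto simp: A_def split: prod.splits)
    qed
  qed (use m n in simp)
  moreover have "card (?h ` A p) = totient (gcd (fst p) (snd p))" if p: "p \<in> ?P" for p
  proof -
    obtain i j where ij: "p = (i, j)" "i dvd m" "j dvd n" using p by auto
    have "card (?h ` A p) * totient (lcm i j) = card (A p)"
      using card_generate_image_ord_eq[OF G.is_group H.is_group finG finH, of i j]
      by (simp add: A_def ij)
    also have "\<dots> = totient i * totient j"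
      using ij m n by (simp add: A_def card_cartesian_product card_integer_mod_group_ord_eq)
    also have "\<dots> = totient (gcd i j) * totient (lcm i j)"
      by (rule totient_gcd_lcm[symmetric])
    finally have "card (?h ` A p) * totient (lcm i j) = totient (gcd i j) * totient (lcm i j)" .
    \<comment> \<open>Positivity makes \<open>totient (lcm i j)\<close> nonzero, so it can be
      cancelled.\<close>
    moreover have "i > 0" "j > 0"
      using ij m n by (simp_all add: dvd_pos_nat)
    ultimately show ?thesis by (simp add: ij)
  qed
  ultimately show ?thesis
    unfolding num_cyclic_subgroups_def by (simp add: case_prod_beta)
qed

text \<open>The second equality is stated in the integers because \<open>moebius_mu\<close> takes
  negative values.\<close>

theorem theorem4p6:
  fixes m n :: nat
  assumes "m \<ge> 1" and "n \<ge> 1"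
  shows "num_cyclic_subgroups m n =
           (\<Sum>(i, j) \<in> {i. i dvd m} \<times> {j. j dvd n}. totient (gcd i j)) \<and>
         int (\<Sum>(i, j) \<in> {i. i dvd m} \<times> {j. j dvd n}. totient (gcd i j)) =
           (\<Sum>t | t dvd gcd m n.
              dirichlet_conv moebius_mu (\<lambda>k. int (totient k)) t
                * int (num_divisors (m div t)) * int (num_divisors (n div t)))"
  using num_cyclic_subgroups_eq[of m n] sum_gcd_divisors[of m n "\<lambda>k. int (totient k)"] assms
  by (simp add: case_prod_beta)

end
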